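(* Let $(X,\tau,E)$ and $(Y,\tau',E)$ be soft topological spaces over the same parameter set $E$, and let $(Y^X,\tau_p,E)$ be the pointwise soft function space. For each $i\in\{0,1,2\}$: if $(Y,\tau',E)$ is a soft $T_i$-space, then $(Y^X,\tau_p,E)$ is also a soft $T_i$-space.
   Context: Universe sets $X,Y$ and the parameter set $E$ of the given soft topological spaces are non-empty. Soft sets: a soft set $(F,E)$ over a set $X$ is a map $F:E\to P(X)$ into the power set of $X$. Inclusions, unions and intersections of soft sets with the same parameter set $E$ are taken parameterwise: $(F,E)\subset(G,E)$ means $F(e)\subset G(e)$ for all $e\in E$, and $(F\cup G)(e)=F(e)\cup G(e)$, $(F\cap G)(e)=F(e)\cap G(e)$, similarly for arbitrary families. $\Phi$ is the soft set with $\Phi(e)=\varnothing$ for all $e\in E$, and $\widetilde X$ is the soft set with $\widetilde X(e)=X$ for all $e\in E$. Soft topology: a soft topology on $X$ (with parameter set $E$) is a collection $\tau$ of soft sets $(F,E)$ over $X$ that contains $\Phi$ and $\widetilde X$ and is closed under arbitrary unions and under intersections of two members; $(X,\tau,E)$ is then a soft topological space and the members of $\tau$ are its soft open sets. A subbase of $\tau$ is a subcollection whose finite intersections form a base, i.e. every member of $\tau$ is a union of such finite intersections. Soft points: for $x\in X$, $e\in E$, the soft point $x_e$ is the soft set with value $\{x\}$ at $e$ and $\varnothing$ at all other parameters; $x_e\in(F,E)$ means $x\in F(e)$. Soft points $x_e$, $y_{e'}$ are different if $x\neq y$ or $e\neq e'$. A soft set $(F,E)$ is a soft neighbourhood of $x_e$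 if there is a soft open $(G,E)$ with $x_e\in(G,E)\subset(F,E)$. Soft mappings: a soft mapping $f=(f,1_E):(X,\tau,E)\to(Y,\tau',E)$ is given by a map $f:X\to Y$ together with the identity of $E$; it sends $x_e$ to $f(x)_e$, the image of $(F,E)$ is $e\mapsto f(F(e))$ and the preimage of $(G,E)$ is $e\mapsto f^{-1}(G(e))$. It is soft continuous if for every soft point $x_e$ of $X$ and every soft neighbourhood $(H,E)$ of $f(x)_e$ there is a soft neighbourhood $(F,E)$ of $x_e$ with $f((F,E))\subset(H,E)$. Function space: $Y^X$ denotes the set of all soft continuous mappings $(f,1_E):(X,\tau,E)\to(Y,\tau',E)$. For a soft point $x_\alpha$ of $X$ the evaluation map $e_{x_\alpha}:(Y^X,E)\to(Y,\tau',E)$ is the soft mapping given by $f\mapsto f(x)$ and the identity on $E$, so that $e_{x_\alpha}^{-1}(G,E)$ is the soft set $e\mapsto\{f\in Y^X: f(x)\in G(e)\}$ over $Y^X$. The pointwise soft topology $\tau_p$ on $Y^X$ is the soft topology with subbase $\{e_{x_\alpha}^{-1}(G,E): x\in X,\ \alpha\in E,\ (G,E)\in\tau'\}$, and $(Y^X,\tau_p,E)$ is called the pointwise soft function space. Separation: $(Y,\tau',E)$ is soft $T_0$ if for any two different soft points there is a soft open set containing one of them and not the other; soft $T_1$ if for any two different soft points $a,b$ there are soft open sets $(F,E),(G,E)$ with $a\in(F,E)$, $b\notin(F,E)$ and $b\in(G,E)$, $a\notin(G,E)$; soft $T_2$ if for any two different soft points $a,b$ there are soft open sets $(F,E)\ni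 a$, $(G,E)\ni b$ with $(F,E)\cap(G,E)=\Phi$. *)

theory Defs
  imports "HOL-Library.FuncSet"
begin

text \<open>
  A soft set over \<open>X\<close> with parameter set \<open>E\<close> is a total function \<open>'e \<Rightarrow> 'a set\<close> that is empty
  outside \<open>E\<close>. With this normalisation, equality of soft sets is equality of functions, and
  parameterwise inclusion, union and intersection are the pointwise lattice operations
  \<open>\<le>\<close>, \<open>Sup\<close> and \<open>inf\<close> on functions into sets; the null soft set is \<open>bot\<close>.
\<close>

definition soft_sets :: "'e set \<Rightarrow> 'a set \<Rightarrow> ('e \<Rightarrow> 'a set) set" where
  "soft_sets E X = {F. (\<forall>e\<in>E. F e \<subseteq> X) \<and> (\<forall>e. e \<notin> E \<longrightarrow> F e = {})}"

definition soft_null :: "'e \<Rightarrow> 'a set" where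
  "soft_null = (\<lambda>e. {})"

definition soft_univ :: "'e set \<Rightarrow> 'a set \<Rightarrow> 'e \<Rightarrow> 'a set" where
  "soft_univ E X = (\<lambda>e. if e \<in> E then X else {})"

definition soft_topology :: "'a set \<Rightarrow> ('e \<Rightarrow> 'a set) set \<Rightarrow> 'e set \<Rightarrow> bool" where
  "soft_topology X \<tau> E \<longleftrightarrow>
     \<tau> \<subseteq> soft_sets E X \<and> soft_null \<in> \<tau> \<and> soft_univ E X \<in> \<tau> \<and>
     (\<forall>\<A>. \<A> \<subseteq> \<tau> \<longrightarrow> Sup \<A> \<in> \<tau>) \<and>
     (\<forall>F\<in>\<tau>. \<forall>G\<in>\<tau>. inf F G \<in> \<tau>)"

definition soft_point :: "'a \<Rightarrow> 'e \<Rightarrow> 'e \<Rightarrow> 'a set" where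
  "soft_point x e = (\<lambda>e'. if e' = e then {x} else {})"

definition soft_points :: "'e set \<Rightarrow> 'a set \<Rightarrow> ('e \<Rightarrow> 'a set) set" where
  "soft_points E X = {soft_point x e | x e. x \<in> X \<and> e \<in> E}"

definition soft_mem :: "('e \<Rightarrow> 'a set) \<Rightarrow> ('e \<Rightarrow> 'a set) \<Rightarrow> bool" where
  "soft_mem p F \<longleftrightarrow> (\<exists>x e. p = soft_point x e \<and> x \<in> F e)"

lemma soft_point_eq_iff: "soft_point x e = soft_point y e' \<longleftrightarrow> x = y \<and> e = e'"
  by (auto simp: soft_point_def fun_eq_iff split: if_splits)

lemma soft_mem_soft_point: "soft_mem (soft_point x e) F \<longleftrightarrow> x \<in> F e"
  by (auto simp: soft_mem_def soft_point_eq_iff)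

definition soft_nbhd ::
  "'a set \<Rightarrow> ('e \<Rightarrow> 'a set) set \<Rightarrow> 'e set \<Rightarrow> ('e \<Rightarrow> 'a set) \<Rightarrow> ('e \<Rightarrow> 'a set) \<Rightarrow> bool" where
  "soft_nbhd X \<tau> E p F \<longleftrightarrow> F \<in> soft_sets E X \<and> (\<exists>G\<in>\<tau>. soft_mem p G \<and> G \<le> F)"

text \<open>A soft mapping \<open>(f, 1\<^sub>E)\<close> is represented by its underlying map \<open>f\<close>.\<close>

definition soft_image :: "('a \<Rightarrow> 'b) \<Rightarrow> ('e \<Rightarrow> 'a set) \<Rightarrow> 'e \<Rightarrow> 'b set" where
  "soft_image f F = (\<lambda>e. f ` F e)"

definition soft_vimage :: "'a set \<Rightarrow> ('a \<Rightarrow> 'b) \<Rightarrow> ('e \<Rightarrow> 'b set) \<Rightarrow> 'e \<Rightarrow> 'a set" where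
  "soft_vimage X f G = (\<lambda>e. {x \<in> X. f x \<in> G e})"

definition soft_continuous ::
  "'a set \<Rightarrow> ('e \<Rightarrow> 'a set) set \<Rightarrow> 'b set \<Rightarrow> ('e \<Rightarrow> 'b set) set \<Rightarrow> 'e set \<Rightarrow> ('a \<Rightarrow> 'b) \<Rightarrow> bool" where
  "soft_continuous X \<tau> Y \<tau>' E f \<longleftrightarrow>
     (\<forall>x\<in>X. \<forall>e\<in>E. \<forall>H. soft_nbhd Y \<tau>' E (soft_point (f x) e) H \<longrightarrow>
        (\<exists>F. soft_nbhd X \<tau> E (soft_point x e) F \<and> soft_image f F \<le> H))"

text \<open>
  Maps are taken in the extensional function space, so that two elements of \<open>Y\<^sup>X\<close> are equal
  iff they agree on \<open>X\<close>.
\<close>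

definition soft_maps ::
  "'a set \<Rightarrow> ('e \<Rightarrow> 'a set) set \<Rightarrow> 'b set \<Rightarrow> ('e \<Rightarrow> 'b set) set \<Rightarrow> 'e set \<Rightarrow> ('a \<Rightarrow> 'b) set" where
  "soft_maps X \<tau> Y \<tau>' E = {f \<in> X \<rightarrow>\<^sub>E Y. soft_continuous X \<tau> Y \<tau>' E f}"

text \<open>
  Finite intersections of members of \<open>\<S>\<close>, computed inside the universe: the intersection of the
  empty family is \<open>soft_univ E X\<close>.
\<close>

definition soft_finite_inters ::
  "'a set \<Rightarrow> 'e set \<Rightarrow> ('e \<Rightarrow> 'a set) set \<Rightarrow> ('e \<Rightarrow> 'a set) set" where
  "soft_finite_inters X E \<S> = {inf (soft_univ E X) (Inf \<A>) | \<A>. finite \<A> \<and> \<A> \<subseteq> \<S>}"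

definition soft_subbase ::
  "'a set \<Rightarrow> ('e \<Rightarrow> 'a set) set \<Rightarrow> 'e set \<Rightarrow> ('e \<Rightarrow> 'a set) set \<Rightarrow> bool" where
  "soft_subbase X \<tau> E \<S> \<longleftrightarrow>
     \<S> \<subseteq> \<tau> \<and> (\<forall>F\<in>\<tau>. \<exists>\<B>. \<B> \<subseteq> soft_finite_inters X E \<S> \<and> F = Sup \<B>)"

definition soft_topology_generated_by ::
  "'a set \<Rightarrow> 'e set \<Rightarrow> ('e \<Rightarrow> 'a set) set \<Rightarrow> ('e \<Rightarrow> 'a set) set" where
  "soft_topology_generated_by X E \<S> = {Sup \<B> | \<B>. \<B> \<subseteq> soft_finite_inters X E \<S>}"

text \<open>
  The generated family is the unique soft topology having \<open>\<S>\<close> as a subbase.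
\<close>

lemma soft_finite_inters_inf:
  assumes "F \<in> soft_finite_inters X E \<S>" "G \<in> soft_finite_inters X E \<S>"
  shows "inf F G \<in> soft_finite_inters X E \<S>"
proof -
  from assms obtain \<A> \<B> where
    "finite \<A>" "\<A> \<subseteq> \<S>" "F = inf (soft_univ E X) (Inf \<A>)"
    "finite \<B>" "\<B> \<subseteq> \<S>" "G = inf (soft_univ E X) (Inf \<B>)"
    unfolding soft_finite_inters_def by blast
  then have "inf F G = inf (soft_univ E X) (Inf (\<A> \<union> \<B>))" "finite (\<A> \<union> \<B>)" "\<A> \<union> \<B> \<subseteq> \<S>"
    by (auto simp: Inf_union_distrib inf.assoc inf.left_commute)
  then show ?thesis
    unfolding soft_finite_inters_def by blast
qed

lemma soft_topology_generated_by:
  fixes X :: "'a set" and E :: "'e set"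
  assumes "\<S> \<subseteq> soft_sets E X"
  shows "soft_topology X (soft_topology_generated_by X E \<S>) E"
  unfolding soft_topology_def
proof (intro conjI allI impI ballI)
  let ?B = "soft_finite_inters X E \<S>" and ?T = "soft_topology_generated_by X E \<S>"
  have B: "F e \<subseteq> soft_univ E X e" if "F \<in> ?B" for F e
    using that by (auto simp: soft_finite_inters_def)
  show "?T \<subseteq> soft_sets E X"
  proof
    fix F assume "F \<in> ?T"
    then obtain \<B> where "\<B> \<subseteq> ?B" "F = Sup \<B>"
      by (auto simp: soft_topology_generated_by_def)
    then have "F e \<subseteq> soft_univ E X e" for e
      using B by (auto simp: subset_iff)
    then show "F \<in> soft_sets E X"
      by (fastforce simp: soft_sets_def soft_univ_def split: if_splits)
  qed
  have "soft_null = Sup ({} :: ('e \<Rightarrow> 'a set) set)"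
    by (simp add: soft_null_def fun_eq_iff)
  then show "soft_null \<in> ?T"
    unfolding soft_topology_generated_by_def by blast
  have "inf (soft_univ E X) (Inf {}) \<in> ?B"
    unfolding soft_finite_inters_def by blast
  then have "{soft_univ E X} \<subseteq> ?B" by simp
  moreover have "soft_univ E X = Sup {soft_univ E X}" by simp
  ultimately show "soft_univ E X \<in> ?T"
    unfolding soft_topology_generated_by_def by blast
  show "Sup \<A> \<in> ?T" if "\<A> \<subseteq> ?T" for \<A>
  proof -
    let ?\<B> = "{G \<in> ?B. \<exists>F\<in>\<A>. G \<le> F}"
    have "Sup \<A> \<le> Sup ?\<B>"
    proof (rule Sup_least)
      fix F assume F: "F \<in> \<A>"
      with that obtain \<B> where \<B>: "\<B> \<subseteq> ?B" "F = Sup \<B>"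
        by (auto simp: soft_topology_generated_by_def)
      then have "\<B> \<subseteq> ?\<B>" using F by (blast intro: Sup_upper)
      then show "F \<le> Sup ?\<B>" using \<B>(2) Sup_subset_mono by blast
    qed
    moreover have "Sup ?\<B> \<le> Sup \<A>"
      by (rule Sup_least) (blast intro: Sup_upper2)
    ultimately have "Sup \<A> = Sup ?\<B>" by (rule antisym)
    then show ?thesis
      unfolding soft_topology_generated_by_def by blast
  qed
  show "inf F G \<in> ?T" if "F \<in> ?T" "G \<in> ?T" for F G
  proof -
    from that obtain \<B> \<C> where *: "\<B> \<subseteq> ?B" "F = Sup \<B>" "\<C> \<subseteq> ?B" "G = Sup \<C>"
      by (auto simp: soft_topology_generated_by_def)
    have "inf F G = Sup ((\<lambda>(U, V). inf U V) ` (\<B> \<times> \<C>))"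
      unfolding *(2,4) by (auto simp: fun_eq_iff)
    moreover have "(\<lambda>(U, V). inf U V) ` (\<B> \<times> \<C>) \<subseteq> ?B"
      using * soft_finite_inters_inf by fastforce
    ultimately show ?thesis
      unfolding soft_topology_generated_by_def by blast
  qed
qed

lemma soft_subbase_generated_by:
  assumes "\<S> \<subseteq> soft_sets E X"
  shows "soft_subbase X (soft_topology_generated_by X E \<S>) E \<S>"
  unfolding soft_subbase_def
proof (intro conjI ballI subsetI)
  fix F assume F: "F \<in> \<S>"
  with assms have "F \<le> soft_univ E X"
    by (auto simp: soft_sets_def soft_univ_def le_fun_def)
  then have "inf (soft_univ E X) (Inf {F}) = F"
    by (simp add: inf.absorb2)
  moreover have "inf (soft_univ E X) (Inf {F}) \<in> soft_finite_inters X E \<S>"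
    using F unfolding soft_finite_inters_def by blast
  ultimately have "{F} \<subseteq> soft_finite_inters X E \<S>" "F = Sup {F}" by auto
  then show "F \<in> soft_topology_generated_by X E \<S>"
    unfolding soft_topology_generated_by_def by blast
next
  fix F assume "F \<in> soft_topology_generated_by X E \<S>"
  then show "\<exists>\<B>. \<B> \<subseteq> soft_finite_inters X E \<S> \<and> F = Sup \<B>"
    by (auto simp: soft_topology_generated_by_def)
qed

lemma soft_topology_generated_by_unique:
  assumes "soft_topology X \<tau> E" "soft_subbase X \<tau> E \<S>"
  shows "\<tau> = soft_topology_generated_by X E \<S>"
proof
  show "\<tau> \<subseteq> soft_topology_generated_by X E \<S>"
    using assms(2) by (auto simp: soft_subbase_def soft_topology_generated_by_def)
  have "inf (soft_univ E X) (Inf \<A>) \<in> \<tau>" if "finite \<A>" "\<A> \<subseteq> \<S>" for \<A>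
    using that
  proof (induction \<A>)
    case empty
    then show ?case using assms(1) by (simp add: soft_topology_def)
  next
    case (insert F \<A>)
    then have "F \<in> \<tau>" "inf (soft_univ E X) (Inf \<A>) \<in> \<tau>"
      using assms(2) unfolding soft_subbase_def by blast+
    then have "inf F (inf (soft_univ E X) (Inf \<A>)) \<in> \<tau>"
      using assms(1) unfolding soft_topology_def by blast
    then show ?case by (simp only: Inf_insert inf.left_commute)
  qed
  then have "soft_finite_inters X E \<S> \<subseteq> \<tau>"
    by (auto simp: soft_finite_inters_def)
  then show "soft_topology_generated_by X E \<S> \<subseteq> \<tau>"
    using assms(1) unfolding soft_topology_def soft_topology_generated_by_def by blast
qed

text \<open>
  The evaluation map at the soft point \<open>x\<^sub>\<alpha>\<close>; its underlying map does not depend on \<open>\<alpha>\<close>.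
\<close>

definition soft_eval :: "'a \<Rightarrow> 'e \<Rightarrow> ('a \<Rightarrow> 'b) \<Rightarrow> 'b" where
  "soft_eval x \<alpha> = (\<lambda>f. f x)"

definition pointwise_subbase ::
  "'a set \<Rightarrow> ('e \<Rightarrow> 'a set) set \<Rightarrow> 'b set \<Rightarrow> ('e \<Rightarrow> 'b set) set \<Rightarrow> 'e set
    \<Rightarrow> ('e \<Rightarrow> ('a \<Rightarrow> 'b) set) set" where
  "pointwise_subbase X \<tau> Y \<tau>' E =
     {soft_vimage (soft_maps X \<tau> Y \<tau>' E) (soft_eval x \<alpha>) G | x \<alpha> G. x \<in> X \<and> \<alpha> \<in> E \<and> G \<in> \<tau>'}"

definition pointwise_soft_topology ::
  "'a set \<Rightarrow> ('e \<Rightarrow> 'a set) set \<Rightarrow> 'b set \<Rightarrow> ('e \<Rightarrow> 'b set) set \<Rightarrow> 'e set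
    \<Rightarrow> ('e \<Rightarrow> ('a \<Rightarrow> 'b) set) set" where
  "pointwise_soft_topology X \<tau> Y \<tau>' E =
     soft_topology_generated_by (soft_maps X \<tau> Y \<tau>' E) E (pointwise_subbase X \<tau> Y \<tau>' E)"

lemma pointwise_subbase_soft_sets:
  assumes "soft_topology Y \<tau>' E"
  shows "pointwise_subbase X \<tau> Y \<tau>' E \<subseteq> soft_sets E (soft_maps X \<tau> Y \<tau>' E)"
  using assms
  by (fastforce simp: pointwise_subbase_def soft_vimage_def soft_topology_def soft_sets_def)

definition soft_T0 :: "'a set \<Rightarrow> ('e \<Rightarrow> 'a set) set \<Rightarrow> 'e set \<Rightarrow> bool" where
  "soft_T0 X \<tau> E \<longleftrightarrow> soft_topology X \<tau> E \<and>
     (\<forall>p\<in>soft_points E X. \<forall>q\<in>soft_points E X. p \<noteq> q \<longrightarrow>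
        (\<exists>F\<in>\<tau>. (soft_mem p F \<and> \<not> soft_mem q F) \<or> (soft_mem q F \<and> \<not> soft_mem p F)))"

definition soft_T1 :: "'a set \<Rightarrow> ('e \<Rightarrow> 'a set) set \<Rightarrow> 'e set \<Rightarrow> bool" where
  "soft_T1 X \<tau> E \<longleftrightarrow> soft_topology X \<tau> E \<and>
     (\<forall>p\<in>soft_points E X. \<forall>q\<in>soft_points E X. p \<noteq> q \<longrightarrow>
        (\<exists>F\<in>\<tau>. \<exists>G\<in>\<tau>. soft_mem p F \<and> \<not> soft_mem q F \<and> soft_mem q G \<and> \<not> soft_mem p G))"

definition soft_T2 :: "'a set \<Rightarrow> ('e \<Rightarrow> 'a set) set \<Rightarrow> 'e set \<Rightarrow> bool" where
  "soft_T2 X \<tau> E \<longleftrightarrow> soft_topology X \<tau> E \<and>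
     (\<forall>p\<in>soft_points E X. \<forall>q\<in>soft_points E X. p \<noteq> q \<longrightarrow>
        (\<exists>F\<in>\<tau>. \<exists>G\<in>\<tau>. soft_mem p F \<and> soft_mem q G \<and> inf F G = soft_null))"

end

theory Submission
  imports Defs
begin

text \<open>
  Separation in the pointwise topology is pulled back along evaluations. Two different soft points
  \<open>f\<^sub>e\<close>, \<open>g\<^sub>d\<close> of the function space have different images under evaluation at some \<open>x \<in> X\<close>: if
  \<open>f \<noteq> g\<close>, choose \<open>x\<close> where they differ, and if \<open>f = g\<close>, then \<open>e \<noteq> d\<close>, which every evaluation
  preserves because it is the identity on parameters; \<open>X \<noteq> {}\<close> supplies the point \<open>x\<close>. The soft
  open sets that separate the images in \<open>Y\<close> have soft open preimages, since these belong to the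
  subbase, and taking preimages preserves membership, non-membership and disjointness.
  The one argument thus covers \<open>T\<^sub>0\<close>, \<open>T\<^sub>1\<close> and \<open>T\<^sub>2\<close>.
\<close>

lemma soft_topology_pointwise:
  assumes "soft_topology Y \<tau>' E"
  shows "soft_topology (soft_maps X \<tau> Y \<tau>' E) (pointwise_soft_topology X \<tau> Y \<tau>' E) E"
  unfolding pointwise_soft_topology_def
  by (rule soft_topology_generated_by[OF pointwise_subbase_soft_sets[OF assms]])

lemma soft_eval_vimage_open:
  assumes "soft_topology Y \<tau>' E" "x \<in> X" "\<alpha> \<in> E" "G \<in> \<tau>'"
  shows "soft_vimage (soft_maps X \<tau> Y \<tau>' E) (soft_eval x \<alpha>) G \<in> pointwise_soft_topology X \<tau> Y \<tau>' E"
proof -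
  have "soft_vimage (soft_maps X \<tau> Y \<tau>' E) (soft_eval x \<alpha>) G \<in> pointwise_subbase X \<tau> Y \<tau>' E"
    using assms(2-4) unfolding pointwise_subbase_def by blast
  moreover have "pointwise_subbase X \<tau> Y \<tau>' E \<subseteq> pointwise_soft_topology X \<tau> Y \<tau>' E"
    using soft_subbase_generated_by[OF pointwise_subbase_soft_sets[OF assms(1)]]
    unfolding soft_subbase_def pointwise_soft_topology_def by blast
  ultimately show ?thesis by blast
qed

lemma soft_mem_vimage:
  "f \<in> M \<Longrightarrow> soft_mem (soft_point f e) (soft_vimage M h G) \<longleftrightarrow> soft_mem (soft_point (h f) e) G"
  by (simp add: soft_mem_soft_point soft_vimage_def)

lemma soft_vimage_disjoint:
  assumes "inf F G = soft_null"
  shows "inf (soft_vimage M h F) (soft_vimage M h G) = soft_null"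
proof -
  have "F e \<inter> G e = {}" for e
    using fun_cong[OF assms, of e] by (simp add: soft_null_def)
  then show ?thesis
    by (auto simp: fun_eq_iff soft_vimage_def soft_null_def)
qed

text \<open>
  The form in which the separation axioms use the family of evaluations: one index serves both
  points, so that a whole separating configuration can be pulled back along a single mapping.
\<close>

lemma soft_eval_separates_soft_points:
  assumes "X \<noteq> {}"
    and "p \<in> soft_points E (soft_maps X \<tau> Y \<tau>' E)" "q \<in> soft_points E (soft_maps X \<tau> Y \<tau>' E)"
    and "p \<noteq> q"
  obtains f e g d x where
    "p = soft_point f e" "q = soft_point g d"
    "f \<in> soft_maps X \<tau> Y \<tau>' E" "g \<in> soft_maps X \<tau> Y \<tau>' E" "x \<in> X" "e \<in> E"
    "soft_point (soft_eval x e f) e \<in> soft_points E Y"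
    "soft_point (soft_eval x e g) d \<in> soft_points E Y"
    "soft_point (soft_eval x e f) e \<noteq> soft_point (soft_eval x e g) d"
proof -
  obtain f e where f: "p = soft_point f e" "f \<in> soft_maps X \<tau> Y \<tau>' E" "e \<in> E"
    using assms(2) unfolding soft_points_def by blast
  obtain g d where g: "q = soft_point g d" "g \<in> soft_maps X \<tau> Y \<tau>' E" "d \<in> E"
    using assms(3) unfolding soft_points_def by blast
  have ext: "f \<in> X \<rightarrow>\<^sub>E Y" "g \<in> X \<rightarrow>\<^sub>E Y"
    using f(2) g(2) by (simp_all add: soft_maps_def)
  have "\<exists>x\<in>X. f x \<noteq> g x \<or> e \<noteq> d"
  proof (cases "e = d")
    case True
    then have "f \<noteq> g" using assms(4) f(1) g(1) by blast
    then show ?thesis using PiE_ext[OF ext] by blast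
  qed (use assms(1) in blast)
  then obtain x where x: "x \<in> X" "f x \<noteq> g x \<or> e \<noteq> d" by blast
  moreover have "f x \<in> Y" "g x \<in> Y"
    using ext x(1) by (auto dest: PiE_mem)
  ultimately show thesis
    using f g by (intro that[of f e g d x])
      (auto simp: soft_points_def soft_eval_def soft_point_eq_iff)
qed

lemma soft_T0_pointwise:
  assumes "X \<noteq> {}" "soft_T0 Y \<tau>' E"
  shows "soft_T0 (soft_maps X \<tau> Y \<tau>' E) (pointwise_soft_topology X \<tau> Y \<tau>' E) E"
  unfolding soft_T0_def
proof (intro conjI ballI impI)
  have top: "soft_topology Y \<tau>' E" using assms(2) by (simp add: soft_T0_def)
  then show "soft_topology (soft_maps X \<tau> Y \<tau>' E) (pointwise_soft_topology X \<tau> Y \<tau>' E) E"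
    by (rule soft_topology_pointwise)
  fix p q
  assume pq: "p \<in> soft_points E (soft_maps X \<tau> Y \<tau>' E)" "q \<in> soft_points E (soft_maps X \<tau> Y \<tau>' E)"
    "p \<noteq> q"
  show "\<exists>F\<in>pointwise_soft_topology X \<tau> Y \<tau>' E.
      (soft_mem p F \<and> \<not> soft_mem q F) \<or> (soft_mem q F \<and> \<not> soft_mem p F)"
    using assms(1) pq
  proof (rule soft_eval_separates_soft_points)
    fix f e g d x
    assume *: "p = soft_point f e" "q = soft_point g d"
      "f \<in> soft_maps X \<tau> Y \<tau>' E" "g \<in> soft_maps X \<tau> Y \<tau>' E" "x \<in> X" "e \<in> E"
      and sep: "soft_point (soft_eval x e f) e \<in> soft_points E Y"
      "soft_point (soft_eval x e g) d \<in> soft_points E Y"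
      "soft_point (soft_eval x e f) e \<noteq> soft_point (soft_eval x e g) d"
    obtain F where "F \<in> \<tau>'"
      "(soft_mem (soft_point (soft_eval x e f) e) F \<and> \<not> soft_mem (soft_point (soft_eval x e g) d) F) \<or>
       (soft_mem (soft_point (soft_eval x e g) d) F \<and> \<not> soft_mem (soft_point (soft_eval x e f) e) F)"
      using assms(2) sep unfolding soft_T0_def by blast
    then show ?thesis
      by (intro bexI[OF _ soft_eval_vimage_open[OF top *(5,6)]]) (simp_all add: *(1-4) soft_mem_vimage)
  qed
qed

lemma soft_T1_pointwise:
  assumes "X \<noteq> {}" "soft_T1 Y \<tau>' E"
  shows "soft_T1 (soft_maps X \<tau> Y \<tau>' E) (pointwise_soft_topology X \<tau> Y \<tau>' E) E"
  unfolding soft_T1_def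
proof (intro conjI ballI impI)
  have top: "soft_topology Y \<tau>' E" using assms(2) by (simp add: soft_T1_def)
  then show "soft_topology (soft_maps X \<tau> Y \<tau>' E) (pointwise_soft_topology X \<tau> Y \<tau>' E) E"
    by (rule soft_topology_pointwise)
  fix p q
  assume pq: "p \<in> soft_points E (soft_maps X \<tau> Y \<tau>' E)" "q \<in> soft_points E (soft_maps X \<tau> Y \<tau>' E)"
    "p \<noteq> q"
  show "\<exists>F\<in>pointwise_soft_topology X \<tau> Y \<tau>' E. \<exists>G\<in>pointwise_soft_topology X \<tau> Y \<tau>' E.
      soft_mem p F \<and> \<not> soft_mem q F \<and> soft_mem q G \<and> \<not> soft_mem p G"
    using assms(1) pq
  proof (rule soft_eval_separates_soft_points)
    fix f e g d x
    assume *: "p = soft_point f e" "q = soft_point g d"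
      "f \<in> soft_maps X \<tau> Y \<tau>' E" "g \<in> soft_maps X \<tau> Y \<tau>' E" "x \<in> X" "e \<in> E"
      and sep: "soft_point (soft_eval x e f) e \<in> soft_points E Y"
      "soft_point (soft_eval x e g) d \<in> soft_points E Y"
      "soft_point (soft_eval x e f) e \<noteq> soft_point (soft_eval x e g) d"
    obtain F G where "F \<in> \<tau>'" "G \<in> \<tau>'"
      "soft_mem (soft_point (soft_eval x e f) e) F" "\<not> soft_mem (soft_point (soft_eval x e g) d) F"
      "soft_mem (soft_point (soft_eval x e g) d) G" "\<not> soft_mem (soft_point (soft_eval x e f) e) G"
      using assms(2) sep unfolding soft_T1_def by blast
    then show ?thesis
      by (intro bexI[OF _ soft_eval_vimage_open[OF top *(5,6), of F]]
          bexI[OF _ soft_eval_vimage_open[OF top *(5,6), of G]])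
        (simp_all add: *(1-4) soft_mem_vimage)
  qed
qed

lemma soft_T2_pointwise:
  assumes "X \<noteq> {}" "soft_T2 Y \<tau>' E"
  shows "soft_T2 (soft_maps X \<tau> Y \<tau>' E) (pointwise_soft_topology X \<tau> Y \<tau>' E) E"
  unfolding soft_T2_def
proof (intro conjI ballI impI)
  have top: "soft_topology Y \<tau>' E" using assms(2) by (simp add: soft_T2_def)
  then show "soft_topology (soft_maps X \<tau> Y \<tau>' E) (pointwise_soft_topology X \<tau> Y \<tau>' E) E"
    by (rule soft_topology_pointwise)
  fix p q
  assume pq: "p \<in> soft_points E (soft_maps X \<tau> Y \<tau>' E)" "q \<in> soft_points E (soft_maps X \<tau> Y \<tau>' E)"
    "p \<noteq> q"
  show "\<exists>F\<in>pointwise_soft_topology X \<tau> Y \<tau>' E. \<exists>G\<in>pointwise_soft_topology X \<tau> Y \<tau>' E.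
      soft_mem p F \<and> soft_mem q G \<and> inf F G = soft_null"
    using assms(1) pq
  proof (rule soft_eval_separates_soft_points)
    fix f e g d x
    assume *: "p = soft_point f e" "q = soft_point g d"
      "f \<in> soft_maps X \<tau> Y \<tau>' E" "g \<in> soft_maps X \<tau> Y \<tau>' E" "x \<in> X" "e \<in> E"
      and sep: "soft_point (soft_eval x e f) e \<in> soft_points E Y"
      "soft_point (soft_eval x e g) d \<in> soft_points E Y"
      "soft_point (soft_eval x e f) e \<noteq> soft_point (soft_eval x e g) d"
    obtain F G where "F \<in> \<tau>'" "G \<in> \<tau>'"
      "soft_mem (soft_point (soft_eval x e f) e) F" "soft_mem (soft_point (soft_eval x e g) d) G"
      "inf F G = soft_null"
      using assms(2) sep unfolding soft_T2_def by blast
    then show ?thesis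
      by (intro bexI[OF _ soft_eval_vimage_open[OF top *(5,6), of F]]
          bexI[OF _ soft_eval_vimage_open[OF top *(5,6), of G]])
        (simp_all add: *(1-4) soft_mem_vimage soft_vimage_disjoint)
  qed
qed

theorem theorem4:
  fixes X :: "'a set" and Y :: "'b set" and E :: "'e set"
    and \<tau> :: "('e \<Rightarrow> 'a set) set" and \<tau>' :: "('e \<Rightarrow> 'b set) set"
  assumes "X \<noteq> {}" and "Y \<noteq> {}" and "E \<noteq> {}"
    and "soft_topology X \<tau> E" and "soft_topology Y \<tau>' E"
  shows "(soft_T0 Y \<tau>' E \<longrightarrow> soft_T0 (soft_maps X \<tau> Y \<tau>' E) (pointwise_soft_topology X \<tau> Y \<tau>' E) E) \<and>
         (soft_T1 Y \<tau>' E \<longrightarrow> soft_T1 (soft_maps X \<tau> Y \<tau>' E) (pointwise_soft_topology X \<tau> Y \<tau>' E) E) \<and>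
         (soft_T2 Y \<tau>' E \<longrightarrow> soft_T2 (soft_maps X \<tau> Y \<tau>' E) (pointwise_soft_topology X \<tau> Y \<tau>' E) E)"
  using assms(1) by (blast intro: soft_T0_pointwise soft_T1_pointwise soft_T2_pointwise)

end
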